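(* Let $A\subset\mathbf{Z}$ be a finite set with $0\in A$, $N=\#A\geq 2$, all elements non-negative, and $A(x)=\sum_{a\in A}x^a$. (i) If $A(x)$ satisfies conditions (T1) and (T2), then $A(x)$ has a spectrum. (ii) If $A(x)$ has a spectrum $\{\theta_1,\dots,\theta_{N-1}\}\subset p^{-\alpha}\mathbf{Z}$, where $p$ is a prime and $\alpha\in\mathbf{N}$, then $N$ is a power of $p$ and (T1) holds.
   Context: For $s\geq 1$, $\Phi_s(x)$ denotes the $s$-th cyclotomic polynomial, $\Phi_s(x)=\prod(x-\epsilon)$ over the primitive $s$-th roots of unity $\epsilon$. $S_A$ is the set of prime powers $s$ (i.e. $s=p^\beta$ with $p$ prime, $\beta\geq1$) such that $\Phi_s(x)$ divides $A(x)$. Condition (T1): $A(1)=\prod_{s\in S_A}\Phi_s(1)$. Condition (T2): if $s_1,\dots,s_k\in S_A$ are powers of pairwise distinct primes, then $\Phi_{s_1s_2\cdots s_k}(x)$ divides $A(x)$. A set $\{\theta_1,\dots,\theta_{N-1}\}\subset(0,1)$ is called a spectrum for $A(x)$ if the $\theta_j$ are pairwise distinct and, with $\theta_0=0$, $A(e^{2\pi i(\theta_i-\theta_j)})=0$ for all $0\leq i,j\leq N-1$ with $i\neq j$. *)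

theory Defs
  imports "HOL-Analysis.Analysis" "HOL-Computational_Algebra.Polynomial"
begin

definition Apoly :: "nat set \<Rightarrow> complex poly" where
  "Apoly A = (\<Sum>a\<in>A. monom 1 a)"

definition cyclotomic :: "nat \<Rightarrow> complex poly" where
  "cyclotomic s = (\<Prod>k\<in>{k. k < s \<and> coprime k s}. [:- cis (2 * pi * real k / real s), 1:])"

definition is_prime_power :: "nat \<Rightarrow> bool" where
  "is_prime_power s \<longleftrightarrow> (\<exists>p \<beta>. prime p \<and> \<beta> \<ge> 1 \<and> s = p ^ \<beta>)"

definition S_set :: "nat set \<Rightarrow> nat set" where
  "S_set A = {s. is_prime_power s \<and> cyclotomic s dvd Apoly A}"

definition T1 :: "nat set \<Rightarrow> bool" where
  "T1 A \<longleftrightarrow> poly (Apoly A) 1 = (\<Prod>s\<in>S_set A. poly (cyclotomic s) 1)"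

definition T2 :: "nat set \<Rightarrow> bool" where
  "T2 A \<longleftrightarrow> (\<forall>T. finite T \<and> T \<noteq> {} \<and> T \<subseteq> S_set A \<and>
       (\<forall>s\<in>T. \<forall>t\<in>T. s \<noteq> t \<longrightarrow> \<not> (\<exists>p. prime p \<and> p dvd s \<and> p dvd t))
     \<longrightarrow> cyclotomic (\<Prod>T) dvd Apoly A)"

definition is_spectrum :: "nat set \<Rightarrow> real set \<Rightarrow> bool" where
  "is_spectrum A \<Theta> \<longleftrightarrow> finite \<Theta> \<and> card \<Theta> = card A - 1 \<and> \<Theta> \<subseteq> {0<..<1} \<and>
     (\<forall>x\<in>insert 0 \<Theta>. \<forall>y\<in>insert 0 \<Theta>. x \<noteq> y \<longrightarrow>
        poly (Apoly A) (exp (2 * pi * \<i> * complex_of_real (x - y))) = 0)"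

end

theory Submission
  imports Defs "HOL-Number_Theory.Totient" "HOL-Number_Theory.Prime_Powers"
begin

text \<open>
  (i) The spectrum consists of the fractional parts of the sums of \<open>k\<^sub>s / s\<close> over \<open>s\<close> in \<open>S\<^sub>A\<close>, where
  \<open>0 \<le> k\<^sub>s < p\<close> for \<open>s\<close> a power of \<open>p\<close>; as \<open>\<Phi>\<^sub>s(1) = p\<close>, (T1) says that there are \<open>N\<close> of them.
  A difference of two such sums has as reduced denominator a product of elements of \<open>S\<^sub>A\<close>, one
  for each prime involved, so (T2) applies.

  (ii) Since \<open>\<Phi>\<^sub>s\<close> is irreducible over the integers for prime powers \<open>s\<close>, any two spectrum points
  differ by a fraction of reduced denominator \<open>s \<in> S\<^sub>A\<close>, so the first base \<open>p\<close> digit (from the right)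
  in which they differ belongs to some power \<open>s\<close> of \<open>p\<close> in \<open>S\<^sub>A\<close>.
  Hence those digits determine the point, and \<open>N\<close> is at most \<open>p\<close> to the number of powers of \<open>p\<close>
  in \<open>S\<^sub>A\<close>. Conversely the product of all \<open>\<Phi>\<^sub>s\<close>, \<open>s \<in> S\<^sub>A\<close>, divides \<open>A\<close> over the integers, so
  the product of all \<open>\<Phi>\<^sub>s(1)\<close> divides \<open>N\<close>.
\<close>

section \<open>Cyclotomic polynomials of prime power order\<close>

abbreviation ipoly :: "int poly \<Rightarrow> complex poly" where
  "ipoly \<equiv> map_poly of_int"

lemma ipoly_add: "ipoly (f + g) = ipoly f + ipoly g"
  by (rule poly_eqI) (simp add: coeff_map_poly)

lemma ipoly_mult: "ipoly (f * g) = ipoly f * ipoly g"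
  by (induction f) (simp_all add: map_poly_pCons ipoly_add map_poly_smult)

lemma ipoly_sum: "ipoly (\<Sum>i\<in>I. f i) = (\<Sum>i\<in>I. ipoly (f i))"
  by (induction I rule: infinite_finite_induct) (simp_all add: ipoly_add)

lemma degree_ipoly: "degree (ipoly f) = degree f"
  by (rule degree_map_poly) simp

lemma ipoly_eq_0_iff: "ipoly f = 0 \<longleftrightarrow> f = 0"
  by (subst map_poly_eq_0_iff) auto

lemma poly_ipoly_of_int: "poly (ipoly f) (of_int c) = of_int (poly f c)"
  by (induction f) (simp_all add: map_poly_pCons)

section \<open>Roots of unity and complex cyclotomic polynomials\<close>

lemma cis_eq_1_iff_int: "cis (2 * pi * x) = 1 \<longleftrightarrow> x \<in> \<int>"
proof
  assume "cis (2 * pi * x) = 1"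
  then have "cos (2 * pi * x) = 1" by (simp add: complex_eq_iff)
  then obtain n :: int where "2 * pi * x = of_int n * 2 * pi"
    using cos_one_2pi_int by blast
  then show "x \<in> \<int>" by simp
qed simp

text \<open>The power is the root of unity with angle \<open>n * k / s\<close>, which is trivial
  exactly when \<open>s\<close> divides \<open>n * k\<close>; coprimality cancels
  \<open>k\<close>.\<close>

lemma cis_root_power_eq_1_iff:
  fixes k :: int
  assumes "coprime k (int s)" "s > 0"
  shows "cis (2 * pi * of_int k / real s) ^ n = 1 \<longleftrightarrow> s dvd n"
proof -
  have "cis (2 * pi * of_int k / real s) ^ n = cis (2 * pi * (of_int (int n * k) / real s))"
    unfolding Complex.DeMoivre by (rule arg_cong[of _ _ cis]) simp
  also have "\<dots> = 1 \<longleftrightarrow> of_int (int n * k) / real s \<in> \<int>"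
    by (rule cis_eq_1_iff_int)
  also have "\<dots> \<longleftrightarrow> int s dvd int n * k"
  proof
    assume "of_int (int n * k) / real s \<in> \<int>"
    then obtain m where "of_int (int n * k) / real s = of_int m" by (elim Ints_cases)
    then have "real_of_int (int n * k) = of_int (int s * m)"
      using assms(2) by (simp add: field_simps)
    then have "int n * k = int s * m" by (simp only: of_int_eq_iff)
    then show "int s dvd int n * k" by simp
  next
    assume "int s dvd int n * k"
    then obtain m where "int n * k = int s * m" by blast
    then have "of_int (int n * k) / real s = of_int m"
      using assms(2) by simp
    then show "of_int (int n * k) / real s \<in> \<int>" by (metis Ints_of_int)
  qed
  also have "\<dots> \<longleftrightarrow> int s dvd int n"
    using assms(1) by (simp add: coprime_commute coprime_dvd_mult_left_iff)
  finally show ?thesis by simp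
qed

lemma cyclotomic_root_iff:
  "poly (cyclotomic s) z = 0 \<longleftrightarrow> (\<exists>k<s. coprime k s \<and> z = cis (2 * pi * real k / real s))"
  unfolding cyclotomic_def by (auto simp: poly_prod prod_zero_iff)

text \<open>Reducing \<open>m\<close> modulo \<open>n\<close> shifts the angle by a multiple of a
  full turn and keeps coprimality. It frees later arguments from the numerator range built into
  \<open>cyclotomic\<close>.\<close>

lemma cyclotomic_root_of_int:
  fixes m :: int
  assumes "coprime m (int n)" "n > 0"
  shows "poly (cyclotomic n) (cis (2 * pi * of_int m / real n)) = 0"
proof -
  define k where "k = nat (m mod int n)"
  have k: "int k = m mod int n" "k < n"
    using assms(2) by (auto simp: k_def nat_less_iff)
  have "coprime (int k) (int n)"
    using assms by (simp add: k(1) ac_simps)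
  then have cop: "coprime k n" by simp
  have "real_of_int m = of_int (m div int n * int n + m mod int n)" by simp
  also have "\<dots> = of_int (m div int n) * real n + real k"
    by (simp flip: k(1))
  finally have "2 * pi * of_int m / real n
      = 2 * pi * of_int (m div int n) + 2 * pi * real k / real n"
    using assms(2) by (simp add: field_simps)
  then have "cis (2 * pi * of_int m / real n) = cis (2 * pi * real k / real n)"
    by (simp flip: cis_mult)
  with k(2) cop show ?thesis by (auto simp: cyclotomic_root_iff)
qed

lemma cyclotomic_root_power_eq_1_iff:
  assumes "poly (cyclotomic s) z = 0"
  shows "z ^ n = 1 \<longleftrightarrow> s dvd n"
proof -
  obtain k where "k < s" "coprime k s" "z = cis (2 * pi * real k / real s)"
    using assms by (auto simp: cyclotomic_root_iff)
  then show ?thesis using cis_root_power_eq_1_iff[of "int k" s n] by simp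
qed

lemma cyclotomic_nonzero [simp]: "cyclotomic s \<noteq> 0"
  by (auto simp: cyclotomic_def prod_zero_iff)

lemma cyclotomic_has_root:
  assumes "s > 1"
  shows "poly (cyclotomic s) (cis (2 * pi / real s)) = 0"
  unfolding cyclotomic_root_iff using assms by (intro exI[of _ 1]) auto

text \<open>A new root is not a root of the product over the old ones, so it must be a root of the
  cofactor.\<close>

lemma prod_linear_dvd:
  fixes p :: "'a::idom poly"
  assumes "finite R" "\<And>r. r \<in> R \<Longrightarrow> poly p r = 0"
  shows "(\<Prod>r\<in>R. [:- r, 1:]) dvd p"
  using assms
proof (induction R)
  case (insert r R)
  then obtain q where q: "p = (\<Prod>r\<in>R. [:- r, 1:]) * q" by (auto elim: dvdE)
  have "poly (\<Prod>r\<in>R. [:- r, 1:]) r \<noteq> 0"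
    using insert.hyps by (auto simp: poly_prod)
  with insert.prems[of r] have "poly q r = 0" by (simp add: q)
  then have "[:- r, 1:] dvd q" by (simp add: poly_eq_0_iff_dvd)
  then show ?case
    unfolding prod.insert[OF insert.hyps] q by (subst mult.commute) (rule mult_dvd_mono[OF dvd_refl])
qed simp

text \<open>Two equal values force \<open>(j - k) / s\<close> to be an integer, and its absolute
  value is below 1.\<close>

lemma cyclotomic_inj_on:
  "inj_on (\<lambda>k. cis (2 * pi * real k / real s)) {k. k < s \<and> coprime k s}"
proof (rule inj_onI)
  fix j k assume jk: "j \<in> {k. k < s \<and> coprime k s}" "k \<in> {k. k < s \<and> coprime k s}"
    and eq: "cis (2 * pi * real j / real s) = cis (2 * pi * real k / real s)"
  have "cis (2 * pi * ((real j - real k) / real s)) =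
      cis (2 * pi * real j / real s) / cis (2 * pi * real k / real s)"
    by (simp add: cis_divide diff_divide_distrib right_diff_distrib)
  also have "\<dots> = 1" by (simp add: eq)
  finally have "(real j - real k) / real s \<in> \<int>" by (simp only: cis_eq_1_iff_int)
  then obtain m where m: "(real j - real k) / real s = of_int m" by (elim Ints_cases)
  have "\<bar>(real j - real k) / real s\<bar> < 1" using jk by (auto simp: field_simps abs_if)
  then have "m = 0" by (simp add: m)
  with m jk show "j = k" by auto
qed

lemma cyclotomic_eq_prod_roots:
  "cyclotomic s = (\<Prod>z\<in>{z. poly (cyclotomic s) z = 0}. [:- z, 1:])"
proof -
  have "{z. poly (cyclotomic s) z = 0}
      = (\<lambda>k. cis (2 * pi * real k / real s)) ` {k. k < s \<and> coprime k s}"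
    by (auto simp: cyclotomic_root_iff)
  then have "(\<Prod>z\<in>{z. poly (cyclotomic s) z = 0}. [:- z, 1:])
      = (\<Prod>k | k < s \<and> coprime k s. [:- cis (2 * pi * real k / real s), 1:])"
    by (simp add: prod.reindex[OF cyclotomic_inj_on])
  then show ?thesis by (simp add: cyclotomic_def)
qed

lemma cyclotomic_dvdI:
  assumes "\<And>z. poly (cyclotomic s) z = 0 \<Longrightarrow> poly f z = 0"
  shows "cyclotomic s dvd f"
  by (subst cyclotomic_eq_prod_roots, rule prod_linear_dvd) (auto simp: poly_roots_finite assms)

lemma degree_cyclotomic:
  assumes "s > 1"
  shows "degree (cyclotomic s) = totient s"
proof -
  have "degree (cyclotomic s) = card {k. k < s \<and> coprime k s}"
    by (simp add: cyclotomic_def degree_prod_eq_sum_degree)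
  \<comment> \<open>\<open>totatives\<close> ranges over positive numbers up to \<open>s\<close>,
    the definition here over numbers from 0 below \<open>s\<close>. For \<open>s > 1\<close> neither
    0 nor \<open>s\<close> is coprime to \<open>s\<close>, so the sets agree.\<close>
  also have "{k. k < s \<and> coprime k s} = totatives s"
    using assms by (auto simp: totatives_def intro!: Nat.gr0I le_neq_implies_less)
  finally show ?thesis by (simp add: totient_def)
qed

lemma lead_coeff_cyclotomic: "lead_coeff (cyclotomic s) = 1"
  by (simp add: cyclotomic_def lead_coeff_prod)

section \<open>The integer polynomial (x^(pq) - 1) / (x^q - 1), which is cyclotomic when q is a
  power of p\<close>

definition prime_cyclo :: "nat \<Rightarrow> nat \<Rightarrow> int poly" where
  "prime_cyclo p q = (\<Sum>i<p. monom 1 (i * q))"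

lemma coeff_prime_cyclo:
  assumes "q > 0"
  shows "coeff (prime_cyclo p q) n = (if q dvd n \<and> n < p * q then 1 else 0)"
proof -
  have "coeff (prime_cyclo p q) n = (\<Sum>i<p. if i * q = n then 1 else 0)"
    by (simp add: prime_cyclo_def coeff_sum)
  also have "\<dots> = (\<Sum>i<p. if i = n div q then (if q dvd n then 1 else 0) else 0)"
    using assms by (intro sum.cong) auto
  also have "\<dots> = (if q dvd n \<and> n < p * q then 1 else 0)"
  proof (cases "q dvd n")
    case True
    then obtain m where "n = q * m" by blast
    then show ?thesis using assms by (simp add: mult.commute[of p])
  qed simp
  finally show ?thesis .
qed

lemma degree_prime_cyclo:
  assumes "q > 0" "p > 0"
  shows "degree (prime_cyclo p q) = q * (p - 1)"
proof (rule antisym)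
  show "degree (prime_cyclo p q) \<le> q * (p - 1)"
  proof (rule degree_le, intro allI impI)
    fix n assume n: "q * (p - 1) < n"
    have "\<not> (q dvd n \<and> n < p * q)"
    proof
      assume "q dvd n \<and> n < p * q"
      then obtain m where "n = q * m" "q * m < q * p" by (auto simp: mult.commute)
      with n have "p - 1 < m" "m < p" by auto
      then show False by simp
    qed
    then show "coeff (prime_cyclo p q) n = 0" by (simp add: coeff_prime_cyclo assms)
  qed
  show "q * (p - 1) \<le> degree (prime_cyclo p q)"
    by (rule le_degree) (use assms in \<open>simp add: coeff_prime_cyclo mult.commute\<close>)
qed

lemma lead_coeff_prime_cyclo:
  assumes "q > 0" "p > 0"
  shows "lead_coeff (prime_cyclo p q) = 1"
  using assms by (simp add: degree_prime_cyclo coeff_prime_cyclo mult.commute)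

lemma poly_prime_cyclo_1: "poly (prime_cyclo p q) 1 = int p"
  by (simp add: prime_cyclo_def poly_sum poly_monom)

lemma prime_cyclo_times:
  "(monom 1 q - 1) * prime_cyclo p q = monom 1 (p * q) - 1"
proof -
  have "prime_cyclo p q = (\<Sum>i<p. monom 1 q ^ i)"
    by (simp add: prime_cyclo_def monom_power mult.commute)
  then show ?thesis
    using power_diff_1_eq[of "monom (1::int) q" p] by (simp add: monom_power mult.commute[of q])
qed

text \<open>A root of the cyclotomic polynomial satisfies z^(pq) = 1 but not z^q = 1 (with q = p^b),
  so it kills the geometric sum. Hence one polynomial divides the other, and both are monic of
  degree q(p - 1).\<close>

lemma ipoly_prime_cyclo:
  assumes "prime p"
  shows "ipoly (prime_cyclo p (p ^ b)) = cyclotomic (p ^ Suc b)"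
proof -
  let ?q = "p ^ b" and ?s = "p ^ Suc b"
  have p: "p > 1" using assms prime_gt_1_nat by simp
  have q: "?q > 0" "?s > 1" using p one_less_power[of p "Suc b"] by auto
  have root: "poly (ipoly (prime_cyclo p ?q)) z = 0" if "poly (cyclotomic ?s) z = 0" for z
  proof -
    have "z ^ ?s = 1" using cyclotomic_root_power_eq_1_iff[OF that, of ?s] by simp
    moreover have "\<not> ?s dvd ?q" using p by (auto dest!: dvd_imp_le)
    then have "z ^ ?q \<noteq> 1" using cyclotomic_root_power_eq_1_iff[OF that, of ?q] by simp
    moreover have "(z ^ ?q - 1) * poly (ipoly (prime_cyclo p ?q)) z = z ^ ?s - 1"
      using power_diff_1_eq[of "z ^ ?q" p]
      by (simp add: prime_cyclo_def ipoly_sum map_poly_monom poly_sum poly_monom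
          flip: power_mult) (simp add: mult.commute)
    ultimately show ?thesis by simp
  qed
  then obtain h where h: "ipoly (prime_cyclo p ?q) = cyclotomic ?s * h"
    using cyclotomic_dvdI dvdE by metis
  have nz: "h \<noteq> 0"
  proof
    assume "h = 0"
    then have "prime_cyclo p ?q = 0" using h by (simp add: ipoly_eq_0_iff)
    then show False using poly_prime_cyclo_1[of p ?q] p by simp
  qed
  have "degree (cyclotomic ?s) = degree (ipoly (prime_cyclo p ?q))"
    using degree_cyclotomic[OF q(2)] totient_prime_power_Suc[OF assms, of b] q p
    by (simp add: degree_ipoly degree_prime_cyclo)
  with h nz have "degree h = 0" by (simp add: degree_mult_eq)
  then obtain c where c: "h = [:c:]" by (auto elim: degree_eq_zeroE)
  have "lead_coeff (ipoly (prime_cyclo p ?q)) = 1"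
    using lead_coeff_prime_cyclo[of ?q p] p q by (simp add: degree_ipoly coeff_map_poly)
  then have "c = 1"
    unfolding h c lead_coeff_mult lead_coeff_cyclotomic by simp
  with h c show ?thesis by (simp add: one_pCons)
qed

section \<open>Irreducibility\<close>

lemma freshmans_dream_poly:
  fixes f :: "int poly"
  assumes "prime p"
  shows "[:int p:] dvd (f + 1) ^ p - (f ^ p + 1)"
proof -
  have p: "p > 1" using assms prime_gt_1_nat by simp
  have "(f + 1) ^ p = (\<Sum>k\<le>p. of_nat (p choose k) * f ^ k)"
    by (simp add: binomial_ring)
  also have "{..p} = insert 0 (insert p {0<..<p})" using p by auto
  also have "(\<Sum>k\<in>\<dots>. of_nat (p choose k) * f ^ k)
      = 1 + (f ^ p + (\<Sum>k\<in>{0<..<p}. of_nat (p choose k) * f ^ k))"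
    using p by simp
  finally have "(f + 1) ^ p - (f ^ p + 1) = (\<Sum>k\<in>{0<..<p}. of_nat (p choose k) * f ^ k)"
    by simp
  also have "[:int p:] dvd \<dots>"
  proof (rule dvd_sum)
    fix k assume "k \<in> {0<..<p}"
    then have "p dvd (p choose k)" using assms by (intro dvd_choose_prime) auto
    then obtain m where "p choose k = p * m" by blast
    then have "(of_nat (p choose k) :: int poly) = [:int p:] * of_nat m"
      by (simp add: of_nat_poly)
    then show "[:int p:] dvd of_nat (p choose k) * f ^ k" by (metis dvd_mult2 dvd_triv_left)
  qed
  finally show ?thesis .
qed

text \<open>Congruent polynomials have congruent \<open>p\<close>-th powers because y - z divides
  y^p - z^p; the case of exponent \<open>p\<close> is then applied to
  \<open>f ^ p ^ b\<close>.\<close>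

lemma freshmans_dream_poly_power:
  fixes f :: "int poly"
  assumes "prime p"
  shows "[:int p:] dvd (f + 1) ^ p ^ b - (f ^ p ^ b + 1)"
proof (induction b)
  case (Suc b)
  let ?y = "(f + 1) ^ p ^ b" and ?z = "f ^ p ^ b + 1"
  have "?y - ?z dvd ?y ^ p - ?z ^ p"
    by (subst power_diff_sumr2) simp
  with Suc have "[:int p:] dvd ?y ^ p - ?z ^ p" by (rule dvd_trans)
  moreover have "[:int p:] dvd ?z ^ p - ((f ^ p ^ b) ^ p + 1)"
    by (rule freshmans_dream_poly[OF assms])
  ultimately have "[:int p:] dvd (?y ^ p - ?z ^ p) + (?z ^ p - ((f ^ p ^ b) ^ p + 1))"
    by (rule dvd_add)
  then have "[:int p:] dvd ?y ^ p - ((f ^ p ^ b) ^ p + 1)" by (simp only: diff_add_cancel add_diff_eq)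
  then show ?case by (simp add: mult.commute[of p] flip: power_mult)
qed simp

text \<open>Modulo \<open>p\<close>, the identity \<open>(x\<^sup>q - 1) \<cdot> \<Phi> = x\<^bsup>pq\<^esup> - 1\<close> becomes
  \<open>x\<^sup>q \<cdot> \<Phi>(x + 1) = x\<^bsup>pq\<^esup>\<close> after the shift.\<close>
lemma prime_cyclo_shift_coeff:
  assumes "prime p" "i < p ^ b * (p - 1)"
  shows "int p dvd coeff (prime_cyclo p (p ^ b) \<circ>\<^sub>p [:1, 1:]) i"
proof -
  let ?q = "p ^ b" and ?X = "[:0, 1:] :: int poly"
  define F where "F = prime_cyclo p ?q \<circ>\<^sub>p [:1, 1:]"
  have p: "p > 1" using assms prime_gt_1_nat by simp
  have X1: "[:1, 1:] = ?X + 1" by (simp add: one_pCons)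
  have hom_pow: "(g ^ n) \<circ>\<^sub>p h = (g \<circ>\<^sub>p h) ^ n" for g h :: "int poly" and n
    by (induction n) (simp_all add: pcompose_mult pcompose_1)
  have comp: "monom 1 n \<circ>\<^sub>p [:1, 1:] = (?X + 1) ^ n" for n
    by (simp add: monom_altdef hom_pow pcompose_pCons one_pCons)
  have eq: "((?X + 1) ^ ?q - 1) * F = (?X + 1) ^ (p ^ Suc b) - 1"
    using arg_cong[OF prime_cyclo_times[of ?q p], of "\<lambda>f. f \<circ>\<^sub>p [:1, 1:]"]
    by (simp add: pcompose_mult pcompose_diff comp F_def pcompose_1)
  obtain u where u: "(?X + 1) ^ ?q - (?X ^ ?q + 1) = [:int p:] * u"
    using freshmans_dream_poly_power[OF assms(1), of ?X b] by (rule dvdE)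
  obtain v where v: "(?X + 1) ^ (p ^ Suc b) - (?X ^ (p ^ Suc b) + 1) = [:int p:] * v"
    using freshmans_dream_poly_power[OF assms(1), of ?X "Suc b"] by (rule dvdE)
  have rearrange: "a * h = d + c * (w - g * h)" if "(a + c * g) * h = d + c * w"
    for a c d g h w :: "int poly"
    using that by (simp add: algebra_simps)
  have "(?X ^ ?q + [:int p:] * u) * F = ?X ^ (p ^ Suc b) + [:int p:] * v"
    using eq unfolding u[symmetric] v[symmetric] by simp
  then have "?X ^ ?q * F = ?X ^ (p ^ Suc b) + [:int p:] * (v - u * F)"
    by (rule rearrange)
  then have "monom 1 ?q * F = monom 1 (p ^ Suc b) + smult (int p) (v - u * F)"
    by (simp add: monom_altdef)
  \<comment> \<open>Index \<open>i + ?q\<close> on the left reads off coefficient \<open>i\<close>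
    of \<open>F\<close>. It lies below \<open>p ^ Suc b\<close>, so on the right only the multiple
    of \<open>p\<close> contributes.\<close>
  then have "coeff (monom 1 ?q * F) (i + ?q) = coeff (monom 1 (p ^ Suc b) + smult (int p) (v - u * F)) (i + ?q)"
    by (rule arg_cong)
  moreover have "i + ?q \<noteq> p ^ Suc b"
  proof -
    have "i + ?q < ?q * (p - 1) + ?q" using assms(2) by simp
    also have "\<dots> = p ^ Suc b" using p by (cases p) auto
    finally show ?thesis by simp
  qed
  ultimately have "coeff F i = int p * coeff (v - u * F) (i + ?q)"
    by (simp add: coeff_monom_mult)
  then show ?thesis by (simp add: F_def)
qed

section \<open>Eisenstein's criterion and its application\<close>

lemma eisenstein:
  fixes f g :: "int poly"
  assumes "prime p" "\<not> p dvd lead_coeff (f * g)"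
    and low: "\<And>i. i < degree (f * g) \<Longrightarrow> p dvd coeff (f * g) i"
    and "\<not> p ^ 2 dvd coeff (f * g) 0"
  shows "degree f = 0 \<or> degree g = 0"
proof -
  \<comment> \<open>Let \<open>i\<close> be the first index at which \<open>p\<close> does not
    divide the coefficient of \<open>f\<close>. Modulo \<open>p\<close>, coefficient
    \<open>i\<close> of the product is that coefficient times the constant term of \<open>g\<close>,
    hence nonzero. So \<open>i\<close> is at least the degree of the product, which leaves no degree
    for \<open>g\<close>.\<close>
  have aux: "degree g = 0"
    if asm: "\<not> p dvd lead_coeff (f * g)" "\<And>i. i < degree (f * g) \<Longrightarrow> p dvd coeff (f * g) i"
      "p dvd coeff f 0" "\<not> p dvd coeff g 0" for f g
  proof -
    have nz: "f \<noteq> 0" "g \<noteq> 0" using asm(1) by auto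
    have "\<not> p dvd lead_coeff f" using asm(1) by (auto simp: lead_coeff_mult)
    then have ex: "\<exists>i. \<not> p dvd coeff f i" by blast
    define i where "i = (LEAST i. \<not> p dvd coeff f i)"
    have i: "\<not> p dvd coeff f i" "\<And>j. j < i \<Longrightarrow> p dvd coeff f j"
      using LeastI_ex[OF ex] not_less_Least by (auto simp: i_def)
    have "coeff (f * g) i = coeff f i * coeff g 0 + (\<Sum>j<i. coeff f j * coeff g (i - j))"
      by (simp add: coeff_mult flip: lessThan_Suc_atMost)
    moreover have "p dvd (\<Sum>j<i. coeff f j * coeff g (i - j))"
      by (rule dvd_sum) (use i(2) in auto)
    moreover have "\<not> p dvd coeff f i * coeff g 0"
      using i(1) asm(4) assms(1) by (simp add: prime_dvd_mult_iff)
    ultimately have "\<not> p dvd coeff (f * g) i" by (simp add: dvd_add_left_iff)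
    with asm(2) have "degree (f * g) \<le> i" by (meson not_le)
    moreover have "i \<le> degree f" using i(1) by (intro le_degree) auto
    ultimately show ?thesis using nz by (simp add: degree_mult_eq)
  qed
  show ?thesis
  proof (cases "degree (f * g) = 0")
    case True
    moreover have "f \<noteq> 0" "g \<noteq> 0" using assms(2) by auto
    ultimately show ?thesis by (simp add: degree_mult_eq)
  next
    case False
    then have "p dvd coeff f 0 * coeff g 0" using low[of 0] by (simp add: coeff_mult)
    moreover have "\<not> (p dvd coeff f 0 \<and> p dvd coeff g 0)"
      using assms(4) by (auto simp: coeff_mult power2_eq_square mult_dvd_mono)
    ultimately consider "p dvd coeff f 0" "\<not> p dvd coeff g 0" | "p dvd coeff g 0" "\<not> p dvd coeff f 0"
      using assms(1) by (auto simp: prime_dvd_mult_iff)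
    then show ?thesis
    proof cases
      case 1
      then show ?thesis using aux[of f g, OF assms(2) low] by simp
    next
      case 2
      then show ?thesis using aux[of g f] assms(2) low by (simp add: mult.commute[of g])
    qed
  qed
qed

text \<open>The shift x -> x + 1 preserves degrees and products, and the constant term of the
  shifted polynomial is the value at 1, namely \<open>p\<close>, so Eisenstein's criterion
  applies.\<close>

lemma prime_cyclo_irreducible:
  assumes "prime p" "prime_cyclo p (p ^ b) = f * g"
  shows "degree f = 0 \<or> degree g = 0"
proof -
  let ?q = "p ^ b"
  define sh where "sh h = h \<circ>\<^sub>p [:1, 1 :: int:]" for h
  have p: "p > 1" using assms prime_gt_1_nat by simp
  have sh: "sh f * sh g = sh (prime_cyclo p ?q)" by (simp add: sh_def assms(2) pcompose_mult)
  have deg: "degree (sh h) = degree h" for h by (simp add: sh_def degree_pcompose)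
  have "degree (sh f) = 0 \<or> degree (sh g) = 0"
  proof (rule eisenstein[of "int p"])
    show "prime (int p)" using assms by simp
    show "\<not> int p dvd lead_coeff (sh f * sh g)"
    proof -
      have "lead_coeff (sh (prime_cyclo p ?q)) = 1"
        using lead_coeff_prime_cyclo[of ?q p] p unfolding sh_def by (subst lead_coeff_comp) auto
      then show ?thesis using p by (simp add: sh)
    qed
    show "int p dvd coeff (sh f * sh g) i" if "i < degree (sh f * sh g)" for i
      using that prime_cyclo_shift_coeff[OF assms(1), of i b] p
      by (simp add: sh deg degree_prime_cyclo) (simp add: sh_def)
    have "coeff (sh f * sh g) 0 = int p"
      unfolding sh by (simp add: sh_def poly_0_coeff_0[symmetric] poly_pcompose poly_prime_cyclo_1)
    moreover have "\<not> int p ^ 2 dvd int p"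
      using p by (auto dest!: zdvd_imp_le simp: power2_eq_square)
    ultimately show "\<not> int p ^ 2 dvd coeff (sh f * sh g) 0" by simp
  qed
  then show ?thesis by (simp add: deg)
qed

text \<open>A nonzero integer polynomial \<open>R\<close> of least degree vanishing at
  \<open>z\<close> divides \<open>prime_cyclo\<close> up to a scalar. Gauss's lemma removes the
  scalar, and irreducibility forces the degrees to agree.\<close>

lemma minimal_vanishing_degree:
  assumes "prime p" "poly (cyclotomic (p ^ Suc b)) z = 0" "f \<noteq> 0" "poly (ipoly f) z = 0"
  shows "p ^ b * (p - 1) \<le> degree f"
proof -
  let ?P = "prime_cyclo p (p ^ b)"
  have p: "p > 1" using assms prime_gt_1_nat by simp
  define V where "V h \<longleftrightarrow> h \<noteq> 0 \<and> poly (ipoly h) z = 0" for h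
  obtain R where R: "V R" and Rmin: "\<And>h. V h \<Longrightarrow> degree R \<le> degree h"
    using ex_has_least_nat[of V f degree] assms by (auto simp: V_def)
  \<comment> \<open>The leading coefficient of \<open>R\<close> may be a non-unit, so division is
    possible only after scaling by some \<open>a\<close>.\<close>
  obtain a Q where aQ: "a \<noteq> 0" "smult a ?P = R * Q + pseudo_mod ?P R"
    using pseudo_mod(1)[of R ?P] R by (auto simp: V_def)
  have "poly (ipoly (smult a ?P)) z = 0"
    using assms(2) by (simp add: map_poly_smult ipoly_prime_cyclo[OF assms(1)] del: power_Suc)
  then have "poly (ipoly (pseudo_mod ?P R)) z = 0"
    using R by (simp add: aQ(2) ipoly_add ipoly_mult V_def)
  moreover have "pseudo_mod ?P R = 0 \<or> degree (pseudo_mod ?P R) < degree R"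
    using R by (intro pseudo_mod(2)) (simp add: V_def)
  ultimately have "pseudo_mod ?P R = 0" using Rmin by (force simp: V_def)
  then have RQ: "smult a ?P = R * Q" using aQ by simp
  have cP: "content ?P = 1"
  proof -
    have "content ?P dvd lead_coeff ?P" by (rule content_dvd_coeff)
    then have "is_unit (content ?P)" using lead_coeff_prime_cyclo[of "p ^ b" p] p by simp
    then show ?thesis by (metis is_unit_normalize normalize_content)
  qed
  have "primitive_part (smult a ?P) = primitive_part R * primitive_part Q"
    unfolding RQ by (rule primitive_part_mult)
  then have "smult (unit_factor a) ?P = primitive_part R * primitive_part Q"
    using primitive_part_prim[OF cP] by (simp add: primitive_part_smult)
  \<comment> \<open>The sign \<open>unit_factor a\<close> is its own inverse; multiplying by it
    moves it from \<open>?P\<close> to the factor coming from \<open>R\<close>.\<close>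
  then have "smult (unit_factor a) (smult (unit_factor a) ?P)
      = smult (unit_factor a) (primitive_part R) * primitive_part Q"
    by simp
  moreover have "unit_factor a * unit_factor a = 1"
    using aQ(1) by (simp add: sgn_if)
  ultimately have fact: "?P = smult (unit_factor a) (primitive_part R) * primitive_part Q"
    by simp
  have degR: "degree (smult (unit_factor a) (primitive_part R)) = degree R"
    using aQ(1) by (simp add: sgn_if)
  have "degree R \<noteq> 0"
  proof
    assume "degree R = 0"
    then obtain c where "R = [:c:]" by (auto elim: degree_eq_zeroE)
    then show False using R by (auto simp: V_def map_poly_pCons)
  qed
  then have degQ: "degree (primitive_part Q) = 0"
    using prime_cyclo_irreducible[OF assms(1) fact] degR by simp
  have "?P \<noteq> 0" using cP by auto
  then have "primitive_part Q \<noteq> 0" "smult (unit_factor a) (primitive_part R) \<noteq> 0"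
    using fact by auto
  then have "degree ?P = degree R"
    using degR degQ by (subst fact) (simp add: degree_mult_eq)
  then have "degree R = p ^ b * (p - 1)" using p by (simp add: degree_prime_cyclo)
  then show ?thesis using Rmin[of f] assms by (simp add: V_def)
qed

text \<open>Pseudo-division by a monic polynomial is genuine division over the integers; the
  remainder vanishes at \<open>z\<close> and has too small a degree to be nonzero.\<close>

lemma prime_cyclo_dvd:
  assumes "prime p" "poly (cyclotomic (p ^ Suc b)) z = 0" "poly (ipoly f) z = 0"
  shows "prime_cyclo p (p ^ b) dvd f"
proof -
  let ?P = "prime_cyclo p (p ^ b)"
  have p: "p > 1" using assms prime_gt_1_nat by simp
  have lc: "lead_coeff ?P = 1" using p by (intro lead_coeff_prime_cyclo) auto
  then have nz: "?P \<noteq> 0" by auto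
  obtain q r where qr: "pseudo_divmod f ?P = (q, r)" by fastforce
  have f: "f = ?P * q + r" and r: "r = 0 \<or> degree r < degree ?P"
    using pseudo_divmod[OF nz qr] lc by simp_all
  have "poly (ipoly r) z = 0"
    using assms(2,3) by (simp add: f ipoly_add ipoly_mult ipoly_prime_cyclo[OF assms(1)] del: power_Suc)
  then have "r = 0"
    using minimal_vanishing_degree[OF assms(1,2), of r] r p by (cases "r = 0") (simp_all add: degree_prime_cyclo)
  then show ?thesis using f by simp
qed

section \<open>Indexing by the prime power alone\<close>

lemma is_prime_power_decompose:
  assumes "is_prime_power s"
  obtains b where "prime (aprimedivisor s)" "s = aprimedivisor s ^ Suc b"
proof -
  obtain p \<beta> where *: "prime p" "\<beta> \<ge> 1" "s = p ^ \<beta>"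
    using assms by (auto simp: is_prime_power_def)
  then have "aprimedivisor s = p" by (simp add: aprimedivisor_prime_power)
  with * show ?thesis by (intro that[of "\<beta> - 1"]) auto
qed

lemma is_prime_power_power_Suc: "prime p \<Longrightarrow> is_prime_power (p ^ Suc b)"
  unfolding is_prime_power_def by (intro exI[of _ p] exI[of _ "Suc b"]) auto

lemma aprimedivisor_power_Suc: "prime (p :: nat) \<Longrightarrow> aprimedivisor (p ^ Suc b) = p"
  by (rule aprimedivisor_prime_power) auto

text \<open>The prime is recovered as \<open>aprimedivisor s\<close>, so that products can run over
  sets of prime powers; the formula is meant for prime powers \<open>s\<close> only.\<close>

definition int_cyclo :: "nat \<Rightarrow> int poly" where
  "int_cyclo s = prime_cyclo (aprimedivisor s) (s div aprimedivisor s)"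

lemma int_cyclo_power_Suc: "prime p \<Longrightarrow> int_cyclo (p ^ Suc b) = prime_cyclo p (p ^ b)"
  using prime_gt_0_nat[of p]
  by (simp add: int_cyclo_def aprimedivisor_power_Suc del: power_Suc) simp

lemma ipoly_int_cyclo: "is_prime_power s \<Longrightarrow> ipoly (int_cyclo s) = cyclotomic s"
  by (metis is_prime_power_decompose int_cyclo_power_Suc ipoly_prime_cyclo)

lemma poly_int_cyclo_1: "poly (int_cyclo s) 1 = int (aprimedivisor s)"
  by (simp add: int_cyclo_def poly_prime_cyclo_1)

lemma poly_cyclotomic_1:
  assumes "is_prime_power s"
  shows "poly (cyclotomic s) 1 = of_nat (aprimedivisor s)"
  using poly_ipoly_of_int[of "int_cyclo s" 1] assms
  by (simp add: ipoly_int_cyclo poly_int_cyclo_1)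

lemma int_cyclo_dvd:
  assumes "is_prime_power s" "poly (cyclotomic s) z = 0" "poly (ipoly f) z = 0"
  shows "int_cyclo s dvd f"
  using assms by (metis is_prime_power_decompose int_cyclo_power_Suc prime_cyclo_dvd)

section \<open>The prime powers in \<open>S\<^sub>A\<close>\<close>

definition int_Apoly :: "nat set \<Rightarrow> int poly" where
  "int_Apoly A = (\<Sum>a\<in>A. monom 1 a)"

lemma ipoly_int_Apoly: "ipoly (int_Apoly A) = Apoly A"
  by (simp add: int_Apoly_def Apoly_def ipoly_sum map_poly_monom)

lemma poly_int_Apoly_1: "poly (int_Apoly A) 1 = int (card A)"
  by (simp add: int_Apoly_def poly_sum poly_monom)

lemma poly_Apoly_1: "poly (Apoly A) 1 = of_nat (card A)"
  by (simp add: Apoly_def poly_sum poly_monom)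

lemma Apoly_nonzero:
  assumes "card A > 0"
  shows "Apoly A \<noteq> 0"
  using poly_Apoly_1[of A] assms by auto

text \<open>Both \<open>s\<close> and \<open>t\<close> are the multiplicative order of
  \<open>z\<close>.\<close>

lemma cyclotomic_root_unique:
  assumes "poly (cyclotomic s) z = 0" "poly (cyclotomic t) z = 0"
  shows "s = t"
  using cyclotomic_root_power_eq_1_iff[OF assms(1)] cyclotomic_root_power_eq_1_iff[OF assms(2)]
  by (metis dvd_antisym dvd_refl)

lemma is_prime_power_gt_1:
  assumes "is_prime_power s"
  shows "s > 1"
proof -
  obtain p \<beta> where "prime p" "\<beta> \<ge> 1" "s = p ^ \<beta>"
    using assms by (auto simp: is_prime_power_def)
  then show ?thesis using one_less_power[OF prime_gt_1_nat] by fastforce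
qed

text \<open>Sending \<open>s\<close> to a primitive \<open>s\<close>-th root of unity embeds
  \<open>S_set A\<close> into the finitely many roots of \<open>Apoly A\<close>.\<close>

lemma finite_S_set:
  assumes "card A > 0"
  shows "finite (S_set A)"
proof (rule inj_on_finite)
  have root: "poly (cyclotomic s) (cis (2 * pi / real s)) = 0" if "s \<in> S_set A" for s
    using that by (intro cyclotomic_has_root is_prime_power_gt_1) (simp add: S_set_def)
  show "inj_on (\<lambda>s. cis (2 * pi / real s)) (S_set A)"
    by (rule inj_onI) (metis root cyclotomic_root_unique)
  show "(\<lambda>s. cis (2 * pi / real s)) ` S_set A \<subseteq> {z. poly (Apoly A) z = 0}"
    using root by (auto simp: S_set_def elim!: dvdE)
  show "finite {z. poly (Apoly A) z = 0}"
    by (rule poly_roots_finite) (rule Apoly_nonzero[OF assms])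
qed

text \<open>A root of the new factor is not a root of the earlier ones, so the cofactor vanishes
  there. One common root already gives divisibility over the integers.\<close>

lemma prod_int_cyclo_dvd:
  assumes "finite F" "F \<subseteq> S_set A"
  shows "(\<Prod>s\<in>F. int_cyclo s) dvd int_Apoly A"
  using assms
proof (induction F)
  case (insert s F)
  then obtain Q where Q: "int_Apoly A = (\<Prod>s\<in>F. int_cyclo s) * Q" by (auto elim: dvdE)
  have s: "is_prime_power s" and dvd: "cyclotomic s dvd Apoly A"
    using insert.prems by (auto simp: S_set_def)
  define z where "z = cis (2 * pi / real s)"
  have z: "poly (cyclotomic s) z = 0"
    unfolding z_def by (rule cyclotomic_has_root[OF is_prime_power_gt_1[OF s]])
  have "poly (ipoly (int_Apoly A)) z = 0"
    using dvd z by (auto simp: ipoly_int_Apoly elim: dvdE)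
  moreover have "poly (ipoly (\<Prod>t\<in>F. int_cyclo t)) z \<noteq> 0"
  proof
    assume "poly (ipoly (\<Prod>t\<in>F. int_cyclo t)) z = 0"
    moreover have "ipoly (\<Prod>t\<in>F. int_cyclo t) = (\<Prod>t\<in>F. ipoly (int_cyclo t))"
      by (induction F rule: infinite_finite_induct) (simp_all add: ipoly_mult)
    ultimately obtain t where t: "t \<in> F" "poly (ipoly (int_cyclo t)) z = 0"
      using insert.hyps by (auto simp: poly_prod prod_zero_iff)
    moreover have "is_prime_power t" using t(1) insert.prems by (auto simp: S_set_def)
    ultimately have "poly (cyclotomic t) z = 0" by (simp add: ipoly_int_cyclo)
    then have "t = s" using z by (rule cyclotomic_root_unique)
    then show False using t(1) insert.hyps by simp
  qed
  ultimately have "poly (ipoly Q) z = 0" by (simp add: Q ipoly_mult)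
  then have "int_cyclo s dvd Q" by (rule int_cyclo_dvd[OF s z])
  then show ?case
    unfolding prod.insert[OF insert.hyps] Q by (subst mult.commute) (rule mult_dvd_mono[OF dvd_refl])
qed simp

text \<open>The divisibility over the integers is evaluated at 1; divisibility over the complex
  numbers would give no information about integers.\<close>

lemma prod_aprimedivisor_dvd_card:
  assumes "card A > 0"
  shows "(\<Prod>s\<in>S_set A. aprimedivisor s) dvd card A"
proof -
  obtain Q where "int_Apoly A = (\<Prod>s\<in>S_set A. int_cyclo s) * Q"
    using prod_int_cyclo_dvd[OF finite_S_set[OF assms] subset_refl] by (rule dvdE)
  then have "poly (int_Apoly A) 1 = poly ((\<Prod>s\<in>S_set A. int_cyclo s) * Q) 1" by simp
  then have "int (card A) = int (\<Prod>s\<in>S_set A. aprimedivisor s) * poly Q 1"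
    by (simp add: poly_int_Apoly_1 poly_prod poly_int_cyclo_1)
  then have "int (\<Prod>s\<in>S_set A. aprimedivisor s) dvd int (card A)" by (metis dvd_triv_left)
  then show ?thesis by (simp only: int_dvd_int_iff)
qed

lemma T1_iff: "T1 A \<longleftrightarrow> card A = (\<Prod>s\<in>S_set A. aprimedivisor s)"
proof -
  have "(\<Prod>s\<in>S_set A. poly (cyclotomic s) 1) = of_nat (\<Prod>s\<in>S_set A. aprimedivisor s)"
    by (simp add: S_set_def poly_cyclotomic_1)
  then show ?thesis unfolding T1_def poly_Apoly_1 by (simp only: of_nat_eq_iff)
qed

section \<open>Spectra of prime power order\<close>

text \<open>The digits at the positions in \<open>J\<close> determine an element of
  \<open>M\<close>: if m - n = p^j u, the quotients by p^j differ by \<open>u\<close>, so digit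
  \<open>j\<close> differs unless \<open>p\<close> divides \<open>u\<close>.\<close>

lemma card_le_power_digits:
  fixes M :: "int set"
  assumes "p > 0" "finite J"
    and diff: "\<And>m n. m \<in> M \<Longrightarrow> n \<in> M \<Longrightarrow> m \<noteq> n \<Longrightarrow>
      \<exists>j\<in>J. \<exists>u. \<not> int p dvd u \<and> m - n = int p ^ j * u"
  shows "card M \<le> p ^ card J"
proof -
  define dig where "dig m = (\<lambda>j\<in>J. (m div int p ^ j) mod int p)" for m
  have inj: "inj_on dig M"
  proof (rule inj_onI, rule ccontr)
    fix m n assume mn: "m \<in> M" "n \<in> M" "dig m = dig n" "m \<noteq> n"
    then obtain j u where ju: "j \<in> J" "\<not> int p dvd u" "m - n = int p ^ j * u"
      using diff by blast
    have "(m div int p ^ j) mod int p = (n div int p ^ j) mod int p"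
      using fun_cong[OF mn(3), of j] ju(1) by (simp add: dig_def)
    moreover have "m = n + u * int p ^ j" using ju(3) by (simp add: algebra_simps)
    then have "m div int p ^ j = n div int p ^ j + u" using assms(1) by simp
    ultimately have "int p dvd (n div int p ^ j + u) - n div int p ^ j"
      by (simp only: mod_eq_dvd_iff)
    then show False using ju(2) by simp
  qed
  have "dig ` M \<subseteq> (\<Pi>\<^sub>E j\<in>J. {0..<int p})" using assms(1) by (auto simp: dig_def)
  then have "card M \<le> card (\<Pi>\<^sub>E j\<in>J. {0..<int p})"
    using inj assms(2) by (intro card_inj_on_le[of dig]) (auto intro!: finite_PiE)
  also have "\<dots> = p ^ card J" using assms(2) by (simp add: card_PiE)
  finally show ?thesis .
qed

lemma exp_two_pi_i_of_real: "exp (2 * pi * \<i> * complex_of_real x) = cis (2 * pi * x)"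
  by (simp add: cis_conv_exp mult_ac)

text \<open>A single root of exact order p^(b+1) suffices, since the integer cyclotomic polynomial
  divides every integer polynomial sharing a root with it.\<close>

lemma mem_S_set_if_root:
  fixes u :: int
  assumes "prime p" "coprime u (int (p ^ Suc b))"
    and "poly (Apoly A) (cis (2 * pi * of_int u / real (p ^ Suc b))) = 0"
  shows "p ^ Suc b \<in> S_set A"
proof -
  let ?s = "p ^ Suc b"
  have s: "is_prime_power ?s" using assms(1) by (rule is_prime_power_power_Suc)
  have "poly (cyclotomic ?s) (cis (2 * pi * of_int u / real ?s)) = 0"
    using assms(1,2) by (intro cyclotomic_root_of_int) (auto simp: prime_gt_0_nat)
  then have "int_cyclo ?s dvd int_Apoly A"
    using assms(3) by (intro int_cyclo_dvd[OF s]) (simp_all only: ipoly_int_Apoly)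
  then obtain Q where "int_Apoly A = int_cyclo ?s * Q" by (rule dvdE)
  then have "Apoly A = cyclotomic ?s * ipoly Q"
    by (simp only: ipoly_mult ipoly_int_cyclo[OF s] flip: ipoly_int_Apoly)
  then show ?thesis using s by (simp add: S_set_def)
qed

lemma spectrum_imp_T1:
  assumes "card A \<ge> 2" "is_spectrum A \<Theta>" "prime p"
    and lattice: "\<Theta> \<subseteq> {x. \<exists>m::int. x = real_of_int m / real p ^ \<alpha>}"
  shows "(\<exists>k. card A = p ^ k) \<and> T1 A"
proof -
  define \<Theta>0 where "\<Theta>0 = insert 0 \<Theta>"
  \<comment> \<open>A difference p^j u / p^\<alpha> with \<open>u\<close> prime to \<open>p\<close>
    has denominator p^(\<alpha>-j), hence this exponent.\<close>
  define J where "J = {j. j < \<alpha> \<and> p ^ (\<alpha> - j) \<in> S_set A}"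
  define Sp where "Sp = {s \<in> S_set A. p dvd s}"
  have p: "p > 1" using assms(3) by (rule prime_gt_1_nat)
  have fin\<Theta>: "finite \<Theta>" and card\<Theta>: "card \<Theta> = card A - 1" and sub\<Theta>: "\<Theta> \<subseteq> {0<..<1}"
    and zero: "\<And>x y. x \<in> \<Theta>0 \<Longrightarrow> y \<in> \<Theta>0 \<Longrightarrow> x \<noteq> y \<Longrightarrow> poly (Apoly A) (cis (2 * pi * (x - y))) = 0"
    using assms(2) unfolding is_spectrum_def \<Theta>0_def exp_two_pi_i_of_real by blast+
  have "0 \<notin> \<Theta>" using sub\<Theta> by auto
  then have card\<Theta>0: "card \<Theta>0 = card A" using fin\<Theta> card\<Theta> assms(1) by (simp add: \<Theta>0_def)
  have bound: "0 \<le> x \<and> x < 1" if "x \<in> \<Theta>0" for x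
    using that sub\<Theta> by (auto simp: \<Theta>0_def)
  have "\<exists>m::int. x = real_of_int m / real p ^ \<alpha>" if "x \<in> \<Theta>0" for x
    using that lattice by (auto simp: \<Theta>0_def intro: exI[of _ 0])
  then obtain g :: "real \<Rightarrow> int" where g: "\<And>x. x \<in> \<Theta>0 \<Longrightarrow> x = real_of_int (g x) / real p ^ \<alpha>"
    by metis
  have "inj_on g \<Theta>0" by (rule inj_onI) (metis g)
  then have "card A = card (g ` \<Theta>0)" by (simp add: card_image card\<Theta>0)
  also have "\<dots> \<le> p ^ card J"
  proof (rule card_le_power_digits)
    show "p > 0" "finite J" using p by (auto simp: J_def)
    fix m n assume "m \<in> g ` \<Theta>0" "n \<in> g ` \<Theta>0" "m \<noteq> n"
    then obtain x y where xy: "x \<in> \<Theta>0" "y \<in> \<Theta>0" "m = g x" "n = g y" "x \<noteq> y" by auto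
    define j where "j = multiplicity (int p) (m - n)"
    have "m - n \<noteq> 0" "\<not> is_unit (int p)" using \<open>m \<noteq> n\<close> p by auto
    then obtain u where u: "m - n = int p ^ j * u" "\<not> int p dvd u"
      unfolding j_def by (rule multiplicity_decompose')
    have diff: "x - y = real_of_int (m - n) / real p ^ \<alpha>"
      using g[OF xy(1)] g[OF xy(2)] by (simp add: xy diff_divide_distrib)
    \<comment> \<open>Points of [0,1) differ by less than 1, so p^j \<le> |m - n| < p^\<alpha>. Thus
      j < \<alpha>, and the reduced denominator is a nontrivial power of \<open>p\<close>.\<close>
    have "\<bar>x - y\<bar> < 1" using bound[OF xy(1)] bound[OF xy(2)] by linarith
    then have "\<bar>real_of_int (m - n)\<bar> < real p ^ \<alpha>" using p by (simp add: diff field_simps)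
    then have "real_of_int \<bar>m - n\<bar> < real_of_int (int p ^ \<alpha>)" by simp
    then have "\<bar>m - n\<bar> < int p ^ \<alpha>" by (simp only: of_int_less_iff)
    moreover have "int p ^ j \<le> \<bar>m - n\<bar>"
      using u p \<open>m \<noteq> n\<close> by (intro zdvd_imp_le) auto
    ultimately have "int p ^ j < int p ^ \<alpha>" by simp
    then have j: "j < \<alpha>" using p by simp
    then obtain b where b: "\<alpha> = j + Suc b" using less_imp_Suc_add by auto
    have "x - y = of_int u / real (p ^ Suc b)"
      unfolding diff u b using p by (simp add: power_add)
    then have "poly (Apoly A) (cis (2 * pi * of_int u / real (p ^ Suc b))) = 0"
      using zero[OF xy(1,2,5)] by (simp only: times_divide_eq_right)
    moreover have "coprime u (int (p ^ Suc b))"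
    proof -
      have "coprime (int p) u" using assms(3) u(2) by (intro prime_imp_coprime) auto
      then have "coprime u (int p ^ Suc b)"
        by (intro coprime_power_right_iff[THEN iffD2] disjI1) (simp add: coprime_commute)
      then show ?thesis by (simp only: of_nat_power)
    qed
    ultimately have "p ^ Suc b \<in> S_set A" using assms(3) by (intro mem_S_set_if_root)
    then have "j \<in> J" using j by (simp add: J_def b)
    then show "\<exists>j\<in>J. \<exists>u. \<not> int p dvd u \<and> m - n = int p ^ j * u" using u by blast
  qed
  also have "\<dots> \<le> p ^ card Sp"
  proof (rule power_increasing)
    have "inj_on (\<lambda>j. p ^ (\<alpha> - j)) J"
      by (rule inj_onI) (use p in \<open>auto simp: J_def\<close>)
    moreover have "(\<lambda>j. p ^ (\<alpha> - j)) ` J \<subseteq> Sp" by (auto simp: J_def Sp_def)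
    moreover have "finite Sp" using finite_S_set[of A] assms(1) by (simp add: Sp_def)
    ultimately show "card J \<le> card Sp" by (rule card_inj_on_le)
  qed (use p in simp)
  finally have le: "card A \<le> p ^ card Sp" .
  have "aprimedivisor s = p" if "s \<in> Sp" for s
  proof -
    have "is_prime_power s" "p dvd s" using that by (auto simp: Sp_def S_set_def)
    then show ?thesis
      by (metis assms(3) is_prime_power_decompose prime_dvd_power primes_dvd_imp_eq)
  qed
  then have "p ^ card Sp = (\<Prod>s\<in>Sp. aprimedivisor s)" by simp
  also have "\<dots> dvd (\<Prod>s\<in>S_set A. aprimedivisor s)"
    using finite_S_set[of A] assms(1) by (intro prod_dvd_prod_subset) (auto simp: Sp_def)
  finally have dvd1: "p ^ card Sp dvd (\<Prod>s\<in>S_set A. aprimedivisor s)" .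
  have dvd2: "(\<Prod>s\<in>S_set A. aprimedivisor s) dvd card A"
    using assms(1) by (intro prod_aprimedivisor_dvd_card) simp
  \<comment> \<open>The chain of divisors from \<open>p ^ card Sp\<close> through the product to
    \<open>card A\<close> meets the upper bound \<open>le\<close> and collapses into equalities.
    This yields both claims.\<close>
  have "p ^ card Sp \<le> card A"
    using dvd_trans[OF dvd1 dvd2] assms(1) by (intro dvd_imp_le) auto
  with le have eq: "card A = p ^ card Sp" by simp
  then have "card A = (\<Prod>s\<in>S_set A. aprimedivisor s)"
    using dvd1 dvd2 by (simp add: dvd_antisym)
  with eq show ?thesis by (auto simp: T1_iff)
qed

section \<open>The spectrum given by (T1) and (T2)\<close>

lemma prime_power_coprime:
  assumes "is_prime_power s" "is_prime_power t" "aprimedivisor s \<noteq> aprimedivisor t"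
  shows "coprime s t"
proof -
  obtain b where b: "prime (aprimedivisor s)" "s = aprimedivisor s ^ Suc b"
    using assms(1) by (rule is_prime_power_decompose)
  obtain c where c: "prime (aprimedivisor t)" "t = aprimedivisor t ^ Suc c"
    using assms(2) by (rule is_prime_power_decompose)
  have "coprime (aprimedivisor s) (aprimedivisor t)"
    using b(1) c(1) assms(3) by (rule primes_coprime)
  then have "coprime (aprimedivisor s ^ Suc b) (aprimedivisor t ^ Suc c)"
    by (simp only: coprime_power_left_iff coprime_power_right_iff simp_thms)
  then show ?thesis by (simp only: b(2)[symmetric] c(2)[symmetric])
qed

lemma prime_power_less_imp_dvd:
  assumes "is_prime_power s" "is_prime_power t" "aprimedivisor s = aprimedivisor t" "s < t"
  shows "s * aprimedivisor s dvd t"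
proof -
  obtain b where b: "prime (aprimedivisor s)" "s = aprimedivisor s ^ Suc b"
    using assms(1) by (rule is_prime_power_decompose)
  obtain c where c: "t = aprimedivisor s ^ Suc c"
    using is_prime_power_decompose[OF assms(2)] assms(3) by metis
  have "aprimedivisor s ^ Suc b < aprimedivisor s ^ Suc c" using assms(4) b(2) c by simp
  then have "b < c" using prime_gt_1_nat[OF b(1)] by (simp only: power_strict_increasing_iff Suc_less_eq)
  then have "aprimedivisor s ^ Suc (Suc b) dvd aprimedivisor s ^ Suc c"
    by (intro le_imp_power_dvd) simp
  moreover have "aprimedivisor s ^ Suc (Suc b) = s * aprimedivisor s"
    unfolding power_Suc2[of _ "Suc b"] b(2)[symmetric] ..
  ultimately show ?thesis by (simp only: c[symmetric])
qed

text \<open>\<open>T\<close> keeps the largest power of each prime in \<open>D\<close>, so its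
  product is the least common multiple of \<open>D\<close>. By the last two claims, among the
  quotients of this product by elements of \<open>D\<close>, only the one by \<open>t\<close>
  escapes divisibility by the prime of \<open>t\<close>.\<close>

lemma top_prime_powers:
  assumes "finite D" "\<forall>s\<in>D. is_prime_power s"
  defines "T \<equiv> {s \<in> D. \<forall>t\<in>D. aprimedivisor t = aprimedivisor s \<longrightarrow> t \<le> s}"
  shows "s \<in> D \<Longrightarrow> \<exists>t\<in>T. aprimedivisor t = aprimedivisor s \<and> s \<le> t"
    and "s \<in> T \<Longrightarrow> t \<in> T \<Longrightarrow> s \<noteq> t \<Longrightarrow> coprime s t"
    and "s \<in> D \<Longrightarrow> s dvd \<Prod>T"
    and "t \<in> T \<Longrightarrow> s \<in> D \<Longrightarrow> s \<noteq> t \<Longrightarrow> aprimedivisor t dvd \<Prod>T div s"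
    and "t \<in> T \<Longrightarrow> \<not> aprimedivisor t dvd \<Prod>T div t"
proof -
  have pp: "s > 0" "prime (aprimedivisor s)" "aprimedivisor s dvd s" if "s \<in> D" for s
    using is_prime_power_gt_1[OF assms(2)[rule_format, OF that]]
    by (auto intro: prime_aprimedivisor' aprimedivisor_dvd')
  have TD: "T \<subseteq> D" by (auto simp: T_def)
  then have finT: "finite T" using assms(1) finite_subset by blast
  show top: "\<exists>t\<in>T. aprimedivisor t = aprimedivisor s \<and> s \<le> t" if "s \<in> D" for s
  proof
    let ?C = "{t \<in> D. aprimedivisor t = aprimedivisor s}"
    have C: "finite ?C" "s \<in> ?C" using assms(1) that by auto
    then have "Max ?C \<in> ?C" by (intro Max_in) auto
    moreover have "\<And>t. t \<in> ?C \<Longrightarrow> t \<le> Max ?C" using C by (intro Max_ge) auto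
    ultimately show "Max ?C \<in> T" "aprimedivisor (Max ?C) = aprimedivisor s \<and> s \<le> Max ?C"
      using that by (auto simp: T_def)
  qed
  show cop: "coprime s t" if "s \<in> T" "t \<in> T" "s \<noteq> t" for s t
  proof (rule prime_power_coprime)
    show "aprimedivisor s \<noteq> aprimedivisor t"
    proof
      assume "aprimedivisor s = aprimedivisor t"
      then have "s \<le> t" "t \<le> s" using that(1,2) by (simp_all add: T_def)
      then show False using that(3) by simp
    qed
  qed (use that TD assms(2) in auto)
  have dvd_top: "s dvd t" if "s \<in> D" "t \<in> D" "aprimedivisor t = aprimedivisor s" "s \<le> t" for s t
  proof (cases "s = t")
    case False
    then have "s * aprimedivisor s dvd t"
      using that assms(2) by (intro prime_power_less_imp_dvd) simp_all
    then show ?thesis by (rule dvd_mult_left)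
  qed simp
  show dvd: "s dvd \<Prod>T" if s: "s \<in> D" for s
  proof -
    obtain t where "t \<in> T" "aprimedivisor t = aprimedivisor s" "s \<le> t" using top[OF s] by blast
    then have "s dvd t" "t dvd \<Prod>T" using dvd_top[of s t] s TD finT by (auto intro: dvd_prodI[of T t "\<lambda>x. x", simplified])
    then show ?thesis by (rule dvd_trans)
  qed
  show "aprimedivisor t dvd \<Prod>T div s" if t: "t \<in> T" and s: "s \<in> D" "s \<noteq> t"
  proof -
    \<comment> \<open>A lower power \<open>s\<close> of the same prime leaves at least one factor of
      that prime in \<open>t\<close>; a power of another prime is coprime to
      \<open>t\<close>.\<close>
    have "s * aprimedivisor t dvd \<Prod>T"
    proof (cases "aprimedivisor s = aprimedivisor t")
      case True
      then have "s < t" using t s by (auto simp: T_def)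
      then have "s * aprimedivisor s dvd t"
        using True s t TD assms(2) by (intro prime_power_less_imp_dvd) auto
      moreover have "t dvd \<Prod>T" using t TD dvd by blast
      ultimately show ?thesis using True by (metis dvd_trans)
    next
      case False
      then have "coprime s t" using s t TD assms(2) by (intro prime_power_coprime) auto
      then have "s * t dvd \<Prod>T" using dvd[of s] dvd[of t] s t TD by (intro divides_mult) auto
      moreover have "s * aprimedivisor t dvd s * t"
        using pp(3)[of t] t TD by (intro mult_dvd_mono) auto
      ultimately show ?thesis by (metis dvd_trans)
    qed
    then show ?thesis using pp(1)[OF s(1)] dvd[OF s(1)] by (simp add: dvd_div_iff_mult mult.commute)
  qed
  show "\<not> aprimedivisor t dvd \<Prod>T div t" if t: "t \<in> T"
  proof
    assume asm: "aprimedivisor t dvd \<Prod>T div t"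
    have "t \<in> D" using t TD by blast
    have "\<Prod>T = t * \<Prod>(T - {t})" using finT t by (rule prod.remove)
    then have "aprimedivisor t dvd \<Prod>(T - {t})" using asm pp(1)[OF \<open>t \<in> D\<close>] by simp
    then obtain s where s: "s \<in> T - {t}" "aprimedivisor t dvd s"
      using pp(2)[OF \<open>t \<in> D\<close>] finT by (auto simp: prime_dvd_prod_iff)
    then have "coprime s t" using cop[of s t] t by auto
    then have "is_unit (aprimedivisor t)" using s(2) pp(3)[OF \<open>t \<in> D\<close>] by (rule coprime_common_divisor)
    then show False using pp(2)[OF \<open>t \<in> D\<close>] by auto
  qed
qed

text \<open>Over the common denominator \<open>n\<close> the sum becomes \<open>m / n\<close> in
  lowest terms. The point is thus a root of the cyclotomic polynomial of order \<open>n\<close>, a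
  product of powers of distinct primes to which (T2) applies.\<close>

lemma T2_root:
  assumes "T2 A" "finite D" "D \<subseteq> S_set A" "D \<noteq> {}"
    and d: "\<And>s. s \<in> D \<Longrightarrow> d s \<noteq> 0 \<and> \<bar>d s\<bar> < int (aprimedivisor s)"
  shows "poly (Apoly A) (cis (2 * pi * (\<Sum>s\<in>D. of_int (d s) / real s))) = 0"
proof -
  define T where "T = {s \<in> D. \<forall>t\<in>D. aprimedivisor t = aprimedivisor s \<longrightarrow> t \<le> s}"
  define n where "n = \<Prod>T"
  define m where "m = (\<Sum>s\<in>D. d s * int (n div s))"
  have pp: "is_prime_power s" if "s \<in> D" for s
    using that assms(3) by (auto simp: S_set_def)
  then have "\<forall>s\<in>D. is_prime_power s" by blast
  note top = top_prime_powers[OF assms(2) this, folded T_def n_def]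
  have TD: "T \<subseteq> D" by (auto simp: T_def)
  then have finT: "finite T" using assms(2) finite_subset by blast
  have pos: "s > 0" if "s \<in> D" for s using is_prime_power_gt_1[OF pp[OF that]] by simp
  have n: "n > 0" unfolding n_def using pos TD by (intro prod_pos) auto
  have "T \<noteq> {}" using top(1) assms(4) by blast
  moreover have "\<not> (\<exists>p. prime p \<and> p dvd s \<and> p dvd t)" if "s \<in> T" "t \<in> T" "s \<noteq> t" for s t :: nat
    using coprime_common_divisor[OF top(2)[OF that]] not_prime_unit by blast
  ultimately have dvdA: "cyclotomic n dvd Apoly A"
    using assms(1)[unfolded T2_def, rule_format, of T] assms(3) finT TD unfolding n_def by blast
  have "coprime m (int n)"
  proof (rule ccontr)
    assume "\<not> coprime m (int n)"
    then obtain c where c: "c dvd m" "c dvd int n" "\<not> is_unit c" by (rule not_coprimeE)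
    moreover from c(2) n have "c \<noteq> 0" by auto
    ultimately obtain r where r: "r dvd c" "prime r" using prime_divisor_exists[of c] by blast
    define q where "q = nat r"
    have rq: "r = int q" using prime_gt_0_int[OF r(2)] by (simp add: q_def)
    have "prime q" using r(2) by (simp add: rq)
    moreover have "int q dvd m" using r(1) c(1) unfolding rq by (rule dvd_trans)
    moreover have "int q dvd int n" using r(1) c(2) unfolding rq by (rule dvd_trans)
    ultimately have q: "prime q" "int q dvd m" "q dvd n" by simp_all
    obtain t where t: "t \<in> T" "q dvd t"
      using q(1,3) finT by (auto simp: n_def prime_dvd_prod_iff)
    have tD: "t \<in> D" using t TD by blast
    have qt: "aprimedivisor t = q"
      using is_prime_power_decompose[OF pp[OF tD]] q(1) t(2)
      by (metis prime_dvd_power primes_dvd_imp_eq)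
    \<comment> \<open>Modulo \<open>q\<close> only the term at \<open>t\<close> survives. It is
      nonzero because \<open>n div t\<close> is free of \<open>q\<close> and 0 < |d t| < q.\<close>
    have "m = d t * int (n div t) + (\<Sum>s\<in>D - {t}. d s * int (n div s))"
      unfolding m_def using assms(2) tD by (rule sum.remove)
    moreover have "int q dvd (\<Sum>s\<in>D - {t}. d s * int (n div s))"
      using top(4)[OF t(1)] qt by (intro dvd_sum dvd_mult) (auto simp: int_dvd_int_iff)
    ultimately have "int q dvd d t * int (n div t)" using q(2) by (simp add: dvd_add_left_iff)
    moreover have "\<not> int q dvd int (n div t)" using top(5)[OF t(1)] qt by (simp add: int_dvd_int_iff)
    moreover have "\<not> int q dvd d t" using d[OF tD] qt dvd_imp_le_int[of "d t" "int q"] by force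
    ultimately show False using q(1) by (simp add: prime_dvd_mult_iff)
  qed
  then have root: "poly (cyclotomic n) (cis (2 * pi * of_int m / real n)) = 0"
    using n by (rule cyclotomic_root_of_int)
  have "of_int m / real n = (\<Sum>s\<in>D. of_int (d s) / real s)"
  proof -
    have "of_int (d s * int (n div s)) / real n = of_int (d s) / real s" if "s \<in> D" for s
    proof -
      have "s dvd n" using that by (rule top(3))
      then obtain k where "n = s * k" by (rule dvdE)
      then show ?thesis using n pos[OF that] by simp
    qed
    then show ?thesis unfolding m_def of_int_sum sum_divide_distrib by (rule sum.cong[OF refl])
  qed
  then have "2 * pi * (\<Sum>s\<in>D. of_int (d s) / real s) = 2 * pi * of_int m / real n"
    by (simp only: times_divide_eq_right[symmetric])
  then show ?thesis using root dvdA by (auto elim!: dvdE)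
qed

lemma T1_T2_imp_spectrum:
  assumes "card A \<ge> 2" "T1 A" "T2 A"
  shows "\<exists>\<Theta>. is_spectrum A \<Theta>"
proof -
  \<comment> \<open>Extensional functions make two distinct choices differ somewhere on
    \<open>S_set A\<close>, and their number is the product in (T1).\<close>
  define K where "K = (\<Pi>\<^sub>E s\<in>S_set A. {..<aprimedivisor s})"
  define \<theta> where "\<theta> k = (\<Sum>s\<in>S_set A. real (k s) / real s)" for k :: "nat \<Rightarrow> nat"
  define \<Theta>0 where "\<Theta>0 = (\<lambda>k. frac (\<theta> k)) ` K"
  have fin: "finite (S_set A)" using assms(1) by (intro finite_S_set) simp
  have zero: "poly (Apoly A) (cis (2 * pi * (\<theta> k - \<theta> l))) = 0"
    if kl: "k \<in> K" "l \<in> K" "k \<noteq> l" for k l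
  proof -
    \<comment> \<open>Places where the choices agree contribute nothing to the difference; elsewhere
      the digit difference is nonzero and smaller than the prime.\<close>
    define D where "D = {s \<in> S_set A. k s \<noteq> l s}"
    have "D \<noteq> {}"
      using kl PiE_ext[OF kl(1,2)[unfolded K_def]] by (auto simp: D_def)
    moreover have "\<theta> k - \<theta> l = (\<Sum>s\<in>S_set A. of_int (int (k s) - int (l s)) / real s)"
      by (simp add: \<theta>_def sum_subtractf diff_divide_distrib)
    then have "\<theta> k - \<theta> l = (\<Sum>s\<in>D. of_int (int (k s) - int (l s)) / real s)"
      using fin by (simp only:) (rule sum.mono_neutral_right, auto simp: D_def)
    moreover have "k s < aprimedivisor s" "l s < aprimedivisor s" if "s \<in> D" for s
      using kl that by (auto simp: K_def D_def)
    then have "int (k s) - int (l s) \<noteq> 0 \<and> \<bar>int (k s) - int (l s)\<bar> < int (aprimedivisor s)"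
      if "s \<in> D" for s
      using that by (force simp: D_def)
    ultimately show ?thesis
      using T2_root[OF assms(3), of D "\<lambda>s. int (k s) - int (l s)"] fin by (auto simp: D_def)
  qed
  have frac_zero: "poly (Apoly A) (cis (2 * pi * (frac (\<theta> k) - frac (\<theta> l)))) = 0"
    if "k \<in> K" "l \<in> K" "k \<noteq> l" for k l
  proof -
    \<comment> \<open>Passing to fractional parts changes the angle by full turns only.\<close>
    have "2 * pi * (\<theta> k - \<theta> l) = 2 * pi * (frac (\<theta> k) - frac (\<theta> l))
        + 2 * pi * of_int (\<lfloor>\<theta> k\<rfloor> - \<lfloor>\<theta> l\<rfloor>)"
      by (simp add: frac_def algebra_simps)
    then have "cis (2 * pi * (\<theta> k - \<theta> l)) = cis (2 * pi * (frac (\<theta> k) - frac (\<theta> l)))"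
      by (simp only: cis_mult[symmetric] cis_multiple_2pi Ints_of_int mult_1_right)
    then show ?thesis using zero[OF that] by simp
  qed
  have inj: "inj_on (\<lambda>k. frac (\<theta> k)) K"
  proof (rule inj_onI, rule ccontr)
    fix k l assume "k \<in> K" "l \<in> K" "frac (\<theta> k) = frac (\<theta> l)" "k \<noteq> l"
    \<comment> \<open>Two choices with the same point would make 1 a root, whereas A(1) = N is
      positive.\<close>
    then have "poly (Apoly A) 1 = 0" using frac_zero[of k l] by simp
    then show False using assms(1) by (simp add: poly_Apoly_1)
  qed
  have "card \<Theta>0 = card K" unfolding \<Theta>0_def using inj by (rule card_image)
  also have "\<dots> = (\<Prod>s\<in>S_set A. aprimedivisor s)" using fin by (simp add: K_def card_PiE)
  also have "\<dots> = card A" using assms(2) by (simp add: T1_iff)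
  finally have card: "card \<Theta>0 = card A" .
  \<comment> \<open>The zero choice gives the point 0, which a spectrum leaves implicit; it is
    removed below, leaving N - 1 points.\<close>
  define k0 where "k0 = (\<lambda>s\<in>S_set A. 0 :: nat)"
  have "aprimedivisor s > 0" if "s \<in> S_set A" for s
    using that by (intro aprimedivisor_pos_nat is_prime_power_gt_1) (simp add: S_set_def)
  then have "k0 \<in> K" by (auto simp: k0_def K_def)
  moreover have "frac (\<theta> k0) = 0" by (simp add: \<theta>_def k0_def)
  ultimately have zero_mem: "0 \<in> \<Theta>0" unfolding \<Theta>0_def by force
  have fin\<Theta>: "finite \<Theta>0" using card assms(1) by (intro card_ge_0_finite) simp
  have "is_spectrum A (\<Theta>0 - {0})"
    unfolding is_spectrum_def insert_Diff[OF zero_mem] exp_two_pi_i_of_real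
  proof (intro conjI ballI impI)
    show "finite (\<Theta>0 - {0})" using fin\<Theta> by simp
    show "card (\<Theta>0 - {0}) = card A - 1" using zero_mem fin\<Theta> card by simp
    show "\<Theta>0 - {0} \<subseteq> {0<..<1}"
      by (auto simp: \<Theta>0_def frac_lt_1 less_le[of 0] intro: frac_ge_0)
    show "poly (Apoly A) (cis (2 * pi * (x - y))) = 0" if "x \<in> \<Theta>0" "y \<in> \<Theta>0" "x \<noteq> y" for x y
      using that frac_zero by (auto simp: \<Theta>0_def)
  qed
  then show ?thesis by blast
qed

theorem mainTheorem1:
  fixes A :: "nat set"
  assumes "finite A" and "0 \<in> A" and "card A \<ge> 2"
  shows "(T1 A \<and> T2 A \<longrightarrow> (\<exists>\<Theta>. is_spectrum A \<Theta>))
       \<and> (\<forall>\<Theta> (p::nat) (\<alpha>::nat). is_spectrum A \<Theta> \<and> prime p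
            \<and> \<Theta> \<subseteq> {x. \<exists>m::int. x = real_of_int m / real p ^ \<alpha>}
          \<longrightarrow> (\<exists>k. card A = p ^ k) \<and> T1 A)"
  using T1_T2_imp_spectrum[OF assms(3)] spectrum_imp_T1[OF assms(3)] by blast

end
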